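(* Let $n\ge 1$ be an integer and $1\le p\le\infty$. For every pair $\mu,\nu\in \mathrm{PL}_\infty^p(\mathbf{R}^n)$ there exist a compact interval $[a,b]\subset\mathbf{R}$ and a $\mathfrak{d}_\infty^p$-absolutely continuous curve $\gamma:[a,b]\to \mathrm{PL}_\infty^p(\mathbf{R}^n)$ such that $\gamma(a)=\mu$ and $\gamma(b)=\nu$.
   Context: $\mathscr{L}^n$ is Lebesgue measure on $\mathbf{R}^n$. $\mathcal{P}_\infty(\mathbf{R}^n)$ is the set of Borel probability measures on $\mathbf{R}^n$ with bounded support. For $\mu,\nu\in\mathcal{P}_\infty(\mathbf{R}^n)$, let $\Gamma(\mu,\nu)$ be the set of Borel probability measures on $\mathbf{R}^n\times\mathbf{R}^n$ with first marginal $\mu$ and second marginal $\nu$, and set $W_\infty(\mu,\nu):=\inf_{\gamma\in\Gamma(\mu,\nu)}\|(x,y)\mapsto|x-y|\,\|_{L^\infty(\gamma)}$. $\mathrm{PL}_\infty^p(\mathbf{R}^n):=\{\mu=f\mathscr{L}^n\in\mathcal{P}_\infty(\mathbf{R}^n): f\in L^p(\mathbf{R}^n)\}$, endowed with the metric $\mathfrak{d}_\infty^p(f\mathscr{L}^n,g\mathscr{L}^n):=W_\infty(f\mathscr{L}^n,g\mathscr{L}^n)+\|f-g\|_{L^p(\mathbf{R}^n)}$. A curve $\omega:[a,b]\to(S,d)$ in a metric space is $d$-absolutely continuous if there exists $m\in L^1([a,b])$ such that $d(\omega(t),\omega(s))\le\int_s^t m(r)\,dr$ for all $a\le s<t\le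 b$. *)

theory Defs
  imports "HOL-Probability.Probability"
begin

section \<open>Lebesgue norms\<close>

text \<open>The norm takes values in \<^typ>\<open>ennreal\<close>, so that membership in the Lebesgue space is finiteness
  of the norm. There is no power function on \<^typ>\<open>ennreal\<close>, hence the separate treatment of an
  infinite integral.\<close>

definition Lp_norm :: "ennreal \<Rightarrow> 'a measure \<Rightarrow> ('a \<Rightarrow> real) \<Rightarrow> ennreal" where
  "Lp_norm p M f =
    (if p = \<infinity> then esssup M (\<lambda>x. ennreal \<bar>f x\<bar>)
     else let I = (\<integral>\<^sup>+x. ennreal (\<bar>f x\<bar> powr enn2real p) \<partial>M)
          in if I = \<infinity> then \<infinity> else ennreal (enn2real I powr (1 / enn2real p)))"

definition Lp_space :: "ennreal \<Rightarrow> 'a measure \<Rightarrow> ('a \<Rightarrow> real) set" where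
  "Lp_space p M = {f \<in> borel_measurable M. Lp_norm p M f < \<infinity>}"

section \<open>The infinity-Wasserstein distance\<close>

definition measure_support :: "'a::topological_space measure \<Rightarrow> 'a set" where
  "measure_support M = {x. \<forall>U. open U \<longrightarrow> x \<in> U \<longrightarrow> 0 < emeasure M U}"

definition P_infty :: "'a::euclidean_space measure set" where
  "P_infty = {M. prob_space M \<and> sets M = sets borel \<and> bounded (measure_support M)}"

definition couplings ::
    "'a::euclidean_space measure \<Rightarrow> 'a measure \<Rightarrow> ('a \<times> 'a) measure set" where
  "couplings M N = {G. prob_space G \<and> sets G = sets borel \<and> distr G borel fst = M \<and> distr G borel snd = N}"

definition W_infty :: "'a::euclidean_space measure \<Rightarrow> 'a measure \<Rightarrow> ennreal" where
  "W_infty M N = (INF G\<in>couplings M N. Lp_norm \<infinity> G (\<lambda>(x, y). norm (x - y)))"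

section \<open>The metric space of measures with p-integrable density\<close>

text \<open>The density \<open>f\<close> is real-valued, and \<^const>\<open>ennreal\<close> truncates negative values to zero, so
  non-negativity of \<open>f\<close> has to be required.\<close>

definition PL_infty :: "ennreal \<Rightarrow> 'a::euclidean_space measure set" where
  "PL_infty p =
    {M \<in> P_infty. \<exists>f \<in> Lp_space p lborel. (AE x in lborel. 0 \<le> f x) \<and> M = density lborel (\<lambda>x. ennreal (f x))}"

definition lebesgue_density :: "'a::euclidean_space measure \<Rightarrow> 'a \<Rightarrow> real" where
  "lebesgue_density M x = enn2real (RN_deriv lborel M x)"

text \<open>The conversion by \<^const>\<open>enn2real\<close> loses nothing on \<^const>\<open>PL_infty\<close>, and the result does not
  depend on the choice of the densities: see \<open>d_infty_density\<close> and \<open>d_infty_finite\<close> below.\<close>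

definition d_infty :: "ennreal \<Rightarrow> 'a::euclidean_space measure \<Rightarrow> 'a measure \<Rightarrow> real" where
  "d_infty p M N =
    enn2real (W_infty M N + Lp_norm p lborel (\<lambda>x. lebesgue_density M x - lebesgue_density N x))"

section \<open>Absolutely continuous curves\<close>

definition abs_continuous_curve ::
    "'s set \<Rightarrow> ('s \<Rightarrow> 's \<Rightarrow> real) \<Rightarrow> real \<Rightarrow> real \<Rightarrow> (real \<Rightarrow> 's) \<Rightarrow> bool" where
  "abs_continuous_curve S d a b \<omega> \<longleftrightarrow>
    (\<forall>t\<in>{a..b}. \<omega> t \<in> S) \<and>
    (\<exists>m. set_integrable lborel {a..b} m \<and>
      (\<forall>s t. a \<le> s \<and> s < t \<and> t \<le> b \<longrightarrow> d (\<omega> t) (\<omega> s) \<le> (LINT r:{s..t}|lborel. m r)))"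

section \<open>Consistency of the definitions\<close>

lemma Lp_norm_AE_cong:
  assumes [measurable]: "f \<in> borel_measurable M" "g \<in> borel_measurable M"
    and ae: "AE x in M. f x = g x"
  shows "Lp_norm p M f = Lp_norm p M g"
proof -
  have "esssup M (\<lambda>x. ennreal \<bar>f x\<bar>) = esssup M (\<lambda>x. ennreal \<bar>g x\<bar>)"
    by (rule esssup_AE_cong) (use ae in auto)
  moreover have "(\<integral>\<^sup>+x. ennreal (\<bar>f x\<bar> powr enn2real p) \<partial>M) = (\<integral>\<^sup>+x. ennreal (\<bar>g x\<bar> powr enn2real p) \<partial>M)"
    by (rule nn_integral_cong_AE) (use ae in auto)
  ultimately show ?thesis by (simp add: Lp_norm_def)
qed

lemma borel_measurable_lebesgue_density[measurable]: "lebesgue_density M \<in> borel_measurable lborel"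
  unfolding lebesgue_density_def[abs_def] by measurable

lemma lebesgue_density_AE:
  fixes f :: "'a::euclidean_space \<Rightarrow> real"
  assumes [measurable]: "f \<in> borel_measurable lborel" and pos: "AE x in lborel. 0 \<le> f x"
  shows "AE x in lborel. lebesgue_density (density lborel (\<lambda>x. ennreal (f x))) x = f x"
proof -
  have "AE x in lborel. ennreal (f x) = RN_deriv lborel (density lborel (\<lambda>x. ennreal (f x))) x"
    by (rule sigma_finite_measure.RN_deriv_unique[OF sigma_finite_lborel]) auto
  with pos show ?thesis
    unfolding lebesgue_density_def by eventually_elim (metis enn2real_ennreal)
qed

lemma d_infty_density:
  fixes f g :: "'a::euclidean_space \<Rightarrow> real"
  assumes [measurable]: "f \<in> borel_measurable lborel" "g \<in> borel_measurable lborel"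
    and "AE x in lborel. 0 \<le> f x" "AE x in lborel. 0 \<le> g x"
    and M: "M = density lborel (\<lambda>x. ennreal (f x))" and N: "N = density lborel (\<lambda>x. ennreal (g x))"
  shows "d_infty p M N = enn2real (W_infty M N + Lp_norm p lborel (\<lambda>x. f x - g x))"
proof -
  have "AE x in lborel. lebesgue_density M x - lebesgue_density N x = f x - g x"
    using lebesgue_density_AE[of f] lebesgue_density_AE[of g] assms by auto
  then have "Lp_norm p lborel (\<lambda>x. lebesgue_density M x - lebesgue_density N x)
           = Lp_norm p lborel (\<lambda>x. f x - g x)"
    by (intro Lp_norm_AE_cong) auto
  then show ?thesis by (simp add: d_infty_def)
qed

lemma AE_measure_support:
  fixes M :: "'a::second_countable_topology measure"
  assumes s: "sets M = sets borel"
  shows "AE x in M. x \<in> measure_support M"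
proof -
  obtain B :: "'a set set" where B: "countable B" "topological_basis B"
    using ex_countable_basis by blast
  define N where "N = (\<Union>U\<in>{U\<in>B. emeasure M U = 0}. U)"
  have "N \<in> null_sets M"
    unfolding N_def
  proof (rule null_sets_UN')
    show "countable {U \<in> B. emeasure M U = 0}"
      using B(1) by (rule countable_subset[rotated]) auto
  next
    fix U assume "U \<in> {U \<in> B. emeasure M U = 0}"
    then show "U \<in> null_sets M"
      using topological_basis_open[OF B(2)] s by (simp add: null_sets_def)
  qed
  moreover have "x \<in> N" if "x \<notin> measure_support M" for x
  proof -
    from that obtain U where U: "open U" "x \<in> U" "emeasure M U = 0"
      by (auto simp: measure_support_def)
    then obtain V where V: "V \<in> B" "x \<in> V" "V \<subseteq> U"
      using topological_basisE[OF B(2)] by metis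
    have "emeasure M V \<le> emeasure M U"
      using V U s by (intro emeasure_mono) auto
    with U V show ?thesis by (auto simp: N_def)
  qed
  ultimately show ?thesis
    by (intro AE_I') auto
qed

lemma W_infty_finite:
  fixes M N :: "'a::euclidean_space measure"
  assumes M: "M \<in> P_infty" and N: "N \<in> P_infty"
  shows "W_infty M N < \<infinity>"
proof -
  interpret M: prob_space M using M by (simp add: P_infty_def)
  interpret N: prob_space N using N by (simp add: P_infty_def)
  interpret P: pair_prob_space M N ..
  have sM[measurable_cong]: "sets M = sets borel" and sN[measurable_cong]: "sets N = sets borel"
    using M N by (auto simp: P_infty_def)
  let ?G = "M \<Otimes>\<^sub>M N"
  have sG[measurable_cong]: "sets ?G = sets borel"
    using sets_pair_measure_cong[OF sM sN] by (metis borel_prod)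
  have [measurable]: "fst \<in> ?G \<rightarrow>\<^sub>M borel" "snd \<in> ?G \<rightarrow>\<^sub>M borel"
    using measurable_fst[of M N] measurable_snd[of M N]
    by (simp_all add: measurable_cong_sets[OF refl sM] measurable_cong_sets[OF refl sN])
  have fst: "distr ?G borel fst = M"
    using N.distr_pair_fst[of M] by (simp cong: distr_cong add: sM[symmetric])
  have snd: "distr ?G borel snd = N"
  proof (rule measure_eqI)
    fix A assume "A \<in> sets (distr ?G borel snd)"
    then have A: "A \<in> sets borel" by simp
    then have "emeasure (distr ?G borel snd) A = emeasure ?G (space M \<times> A)"
      using sN sets.sets_into_space[of A N]
      by (subst emeasure_distr) (auto simp: space_pair_measure \<open>snd \<in> ?G \<rightarrow>\<^sub>M borel\<close> intro!: arg_cong[where f="emeasure ?G"])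
    also have "\<dots> = emeasure N A"
      using A sN by (subst N.emeasure_pair_measure_Times) (auto simp: M.emeasure_space_1)
    finally show "emeasure (distr ?G borel snd) A = emeasure N A" .
  qed (simp add: sN)
  have G: "?G \<in> couplings M N"
    using fst snd sG P.prob_space_axioms by (simp add: couplings_def)
  obtain c where c: "\<And>x. x \<in> measure_support M \<Longrightarrow> norm x \<le> c"
    using M by (auto simp: P_infty_def bounded_iff)
  obtain d where d: "\<And>x. x \<in> measure_support N \<Longrightarrow> norm x \<le> d"
    using N by (auto simp: P_infty_def bounded_iff)
  have 1: "AE z in ?G. norm (fst z) \<le> c"
  proof -
    have "AE x in distr ?G borel fst. norm x \<le> c"
      unfolding fst using AE_measure_support[OF sM] by (rule AE_mp) (use c in auto)
    then show ?thesis by (subst (asm) AE_distr_iff) auto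
  qed
  have 2: "AE z in ?G. norm (snd z) \<le> d"
  proof -
    have "AE x in distr ?G borel snd. norm x \<le> d"
      unfolding snd using AE_measure_support[OF sN] by (rule AE_mp) (use d in auto)
    then show ?thesis by (subst (asm) AE_distr_iff) auto
  qed
  have "W_infty M N \<le> Lp_norm \<infinity> ?G (\<lambda>(x, y). norm (x - y))"
    unfolding W_infty_def using G by (rule INF_lower)
  also have "\<dots> \<le> ennreal (c + d)"
  proof -
    have "AE z in ?G. ennreal \<bar>case z of (x, y) \<Rightarrow> norm (x - y)\<bar> \<le> ennreal (c + d)"
      using 1 2
    proof eventually_elim
      case (elim z)
      then show ?case
        using norm_triangle_ineq4[of "fst z" "snd z"] by (auto simp: split_beta intro!: ennreal_leI)
    qed
    then show ?thesis
      unfolding Lp_norm_def by (auto intro!: esssup_I)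
  qed
  also have "\<dots> < \<infinity>" by simp
  finally show ?thesis .
qed

lemma Lp_norm_diff_finite:
  assumes f: "f \<in> Lp_space p M" and g: "g \<in> Lp_space p M"
  shows "Lp_norm p M (\<lambda>x. f x - g x) < \<infinity>"
proof (cases "p = \<infinity>")
  case True
  let ?e = "\<lambda>f. esssup M (\<lambda>x. ennreal \<bar>f x\<bar>)"
  have [measurable]: "f \<in> borel_measurable M" "g \<in> borel_measurable M"
    and fin: "?e f < \<infinity>" "?e g < \<infinity>"
    using f g True by (auto simp: Lp_space_def Lp_norm_def)
  have "AE x in M. ennreal \<bar>f x - g x\<bar> \<le> ?e f + ?e g"
    using esssup_AE[of "\<lambda>x. ennreal \<bar>f x\<bar>" M] esssup_AE[of "\<lambda>x. ennreal \<bar>g x\<bar>" M]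
  proof eventually_elim
    case (elim x)
    have "ennreal \<bar>f x - g x\<bar> \<le> ennreal \<bar>f x\<bar> + ennreal \<bar>g x\<bar>"
      by (subst ennreal_plus[symmetric]) (auto simp del: ennreal_plus intro!: ennreal_leI)
    with elim show ?case by (meson add_mono order_trans)
  qed
  then have "?e (\<lambda>x. f x - g x) \<le> ?e f + ?e g" by (intro esssup_I) auto
  also have "\<dots> < \<infinity>" using fin by auto
  finally show ?thesis using True by (simp add: Lp_norm_def)
next
  case False
  define q where "q = enn2real p"
  have q: "0 \<le> q" by (simp add: q_def)
  have [measurable]: "f \<in> borel_measurable M" "g \<in> borel_measurable M"
    and fin: "(\<integral>\<^sup>+x. ennreal (\<bar>f x\<bar> powr q) \<partial>M) < \<infinity>" "(\<integral>\<^sup>+x. ennreal (\<bar>g x\<bar> powr q) \<partial>M) < \<infinity>"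
    using f g False by (auto simp: Lp_space_def Lp_norm_def q_def Let_def less_top[symmetric] split: if_splits)
  have le: "\<bar>u - v\<bar> powr q \<le> 2 powr q * (\<bar>u\<bar> powr q + \<bar>v\<bar> powr q)" for u v :: real
  proof -
    have "\<bar>u - v\<bar> powr q \<le> (2 * max \<bar>u\<bar> \<bar>v\<bar>) powr q"
      using q by (intro powr_mono2) auto
    also have "\<dots> = 2 powr q * max \<bar>u\<bar> \<bar>v\<bar> powr q" by (simp add: powr_mult)
    also have "\<dots> \<le> 2 powr q * (\<bar>u\<bar> powr q + \<bar>v\<bar> powr q)"
      by (intro mult_left_mono) (auto simp: max_def)
    finally show ?thesis .
  qed
  have "(\<integral>\<^sup>+x. ennreal (\<bar>f x - g x\<bar> powr q) \<partial>M)
      \<le> (\<integral>\<^sup>+x. ennreal (2 powr q) * (ennreal (\<bar>f x\<bar> powr q) + ennreal (\<bar>g x\<bar> powr q)) \<partial>M)"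
    by (intro nn_integral_mono)
       (auto simp: ennreal_mult[symmetric] ennreal_plus[symmetric] simp del: ennreal_plus intro!: ennreal_leI le)
  also have "\<dots> = ennreal (2 powr q) *
      ((\<integral>\<^sup>+x. ennreal (\<bar>f x\<bar> powr q) \<partial>M) + (\<integral>\<^sup>+x. ennreal (\<bar>g x\<bar> powr q) \<partial>M))"
    by (simp add: nn_integral_cmult nn_integral_add)
  also have "\<dots> < \<infinity>" using fin by (auto simp: ennreal_mult_less_top)
  finally show ?thesis using False by (auto simp: Lp_norm_def q_def Let_def)
qed

lemma d_infty_finite:
  fixes M N :: "'a::euclidean_space measure"
  assumes "M \<in> PL_infty p" and "N \<in> PL_infty p"
  shows "W_infty M N + Lp_norm p lborel (\<lambda>x. lebesgue_density M x - lebesgue_density N x) < \<infinity>"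
proof -
  have *: "lebesgue_density K \<in> Lp_space p lborel" if "K \<in> PL_infty p" for K :: "'a measure"
  proof -
    from that obtain f where f: "f \<in> Lp_space p lborel" "AE x in lborel. 0 \<le> f x"
      "K = density lborel (\<lambda>x. ennreal (f x))" by (auto simp: PL_infty_def)
    then have "Lp_norm p lborel (lebesgue_density K) = Lp_norm p lborel f"
      using lebesgue_density_AE[of f] by (intro Lp_norm_AE_cong) (auto simp: Lp_space_def)
    with f show ?thesis by (simp add: Lp_space_def)
  qed
  have "W_infty M N < \<infinity>" using assms by (intro W_infty_finite) (auto simp: PL_infty_def)
  with Lp_norm_diff_finite[OF *[OF assms(1)] *[OF assms(2)]] show ?thesis by auto
qed

end

theory Submission
  imports Defs
begin

text \<open>Let \<open>Y\<close>, \<open>V\<close> and \<open>U\<close> be independent with laws \<open>\<mu>\<close>, \<open>\<nu>\<close> and the uniform law on \<open>[0, 1]\<close>. A particle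
  rests at \<open>Y\<close> until the random time \<open>U\<close>, then moves to \<open>V\<close> at constant speed during one unit of time,
  and rests at \<open>V\<close> afterwards; let \<open>\<gamma>(t)\<close>, for \<open>t\<close> in \<open>[0, 2]\<close>, be the law of its position. The paths are
  uniformly Lipschitz because \<open>Y\<close> and \<open>V\<close> are bounded, so \<open>\<gamma>\<close> is Lipschitz for \<open>W\<^sub>\<infinity>\<close>. If \<open>h\<^sub>r\<close>
  denotes the density of \<open>(1 - r) Y + r V\<close>, with \<open>r\<close> clamped to \<open>[0, 1]\<close>, the density of \<open>\<gamma>(t)\<close> is
  the integral of \<open>h\<^sub>r\<close> over \<open>r\<close> in \<open>[t - 1, t]\<close>: the random delay averages out the possible
  discontinuity of \<open>h\<^sub>r\<close> in \<open>r\<close>. By Jensen's inequality the \<open>L\<^sup>p\<close> norms of the \<open>h\<^sub>r\<close> are bounded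
  uniformly in \<open>r\<close>, so \<open>\<gamma>\<close> is Lipschitz in \<open>L\<^sup>p\<close> as well.\<close>

section \<open>Lebesgue norm bounds for extended non-negative functions\<close>

text \<open>Infinity is treated apart because \<open>enn2real\<close> sends it to 0. For finite
  \<open>p\<close>, \<open>Lp_norm\<close> follows the same convention when it takes the root of the
  integral.\<close>

definition ennpowr :: "ennreal \<Rightarrow> real \<Rightarrow> ennreal" where
  "ennpowr x q = (if x = \<infinity> then \<infinity> else ennreal (enn2real x powr q))"

lemma ennpowr_ennreal: "0 \<le> x \<Longrightarrow> ennpowr (ennreal x) q = ennreal (x powr q)"
  by (simp add: ennpowr_def)

lemma ennpowr_mono:
  assumes "x \<le> y" "0 \<le> q"
  shows "ennpowr x q \<le> ennpowr y q"
  using assms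
  by (auto simp: ennpowr_def top_unique less_top intro!: ennreal_leI powr_mono2 enn2real_mono)

lemma borel_measurable_ennpowr[measurable (raw)]:
  assumes [measurable]: "f \<in> borel_measurable M"
  shows "(\<lambda>x. ennpowr (f x) q) \<in> borel_measurable M"
  unfolding ennpowr_def by measurable

lemma ennpowr_cmult:
  assumes "0 \<le> c" "0 < q"
  shows "ennpowr (ennreal c * x) q = ennreal (c powr q) * ennpowr x q"
proof (cases x)
  case (real r)
  then show ?thesis
    using assms by (simp add: ennreal_mult[symmetric] ennpowr_ennreal powr_mult)
next
  case top
  then show ?thesis
    using assms by (cases "c = 0") (auto simp: ennpowr_def ennreal_mult_top ennreal_0)
qed

text \<open>The convex function x^q lies above its tangent at \<open>a\<close>. The negative
  constant of the tangent is moved to the other side, so that no subtraction occurs in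
  \<open>ennreal\<close> and \<open>x\<close> may be infinite. For positive reals this is Young's
  inequality for x^q and a^q with weights 1/q and 1 - 1/q.\<close>

lemma ennpowr_tangent:
  assumes a: "0 \<le> a" and q: "1 \<le> q"
  shows "ennreal (q * a powr (q - 1)) * x \<le> ennpowr x q + ennreal ((q - 1) * a powr q)"
proof (cases x)
  case (real r)
  have "q * a powr (q - 1) * r \<le> r powr q + (q - 1) * a powr q"
  \<comment> \<open>Young's inequality is applied to positive numbers. The degenerate case is
    immediate because \<open>0 powr y\<close> is 0 for every \<open>y\<close>, even for
    \<open>y = 0\<close>, which occurs when \<open>q = 1\<close>.\<close>
  proof (cases "a = 0 \<or> r = 0")
    case True
    then show ?thesis using q a real by auto
  next
    case False
    then have pos: "0 < a" "0 < r" using a real by auto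
    have "(r powr q) powr (1 / q) * (a powr q) powr (1 - 1 / q) \<le> 1 / q * r powr q + (1 - 1 / q) * a powr q"
      using pos q by (intro Youngs_inequality_0) auto
    moreover have "q * (1 - 1 / q) = q - 1"
      using q by (simp add: field_simps)
    ultimately have "r * a powr (q - 1) \<le> 1 / q * r powr q + (1 - 1 / q) * a powr q"
      using pos q by (simp add: powr_powr)
    then have "q * (r * a powr (q - 1)) \<le> q * (1 / q * r powr q + (1 - 1 / q) * a powr q)"
      using q by (intro mult_left_mono) auto
    also have "\<dots> = r powr q + (q - 1) * a powr q"
      using q by (simp add: field_simps)
    finally show ?thesis by (simp add: mult_ac)
  qed
  then show ?thesis
    using real q a by (simp add: ennpowr_ennreal ennreal_mult[symmetric] ennreal_plus[symmetric] del: ennreal_plus)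
next
  case top
  then show ?thesis by (simp add: ennpowr_def)
qed

text \<open>Integrating the tangent-line inequality at the mean needs no integrability assumption.\<close>

lemma (in prob_space) ennpowr_nn_integral_le:
  assumes q: "1 \<le> q" and [measurable]: "H \<in> borel_measurable M"
  shows "ennpowr (\<integral>\<^sup>+w. H w \<partial>M) q \<le> (\<integral>\<^sup>+w. ennpowr (H w) q \<partial>M)"
proof -
  have tangent: "ennreal (q * a powr (q - 1)) * (\<integral>\<^sup>+w. H w \<partial>M)
      \<le> (\<integral>\<^sup>+w. ennpowr (H w) q \<partial>M) + ennreal ((q - 1) * a powr q)" if "0 \<le> a" for a
  proof -
    have "ennreal (q * a powr (q - 1)) * (\<integral>\<^sup>+w. H w \<partial>M) = (\<integral>\<^sup>+w. ennreal (q * a powr (q - 1)) * H w \<partial>M)"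
      by (simp add: nn_integral_cmult)
    also have "\<dots> \<le> (\<integral>\<^sup>+w. ennpowr (H w) q + ennreal ((q - 1) * a powr q) \<partial>M)"
      by (intro nn_integral_mono ennpowr_tangent that q)
    also have "\<dots> = (\<integral>\<^sup>+w. ennpowr (H w) q \<partial>M) + ennreal ((q - 1) * a powr q)"
      by (simp add: nn_integral_add emeasure_space_1)
    finally show ?thesis .
  qed
  show ?thesis
  proof (cases "\<integral>\<^sup>+w. H w \<partial>M")
    case top
    \<comment> \<open>The mean is infinite, so any tangent of positive slope does; the one at 1 has
      slope \<open>q\<close>.\<close>
    have "\<infinity> = (\<integral>\<^sup>+w. ennpowr (H w) q \<partial>M) + ennreal (q - 1)"
      using tangent[of 1] q by (simp add: top ennreal_mult_top top_unique)
    then have "(\<integral>\<^sup>+w. ennpowr (H w) q \<partial>M) = \<infinity>"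
      by (metis ennreal_add_eq_top ennreal_neq_top infinity_ennreal_def)
    then show ?thesis by simp
  next
    case (real m)
    show ?thesis
    proof (cases "\<integral>\<^sup>+w. ennpowr (H w) q \<partial>M")
      case (real I)
      have "m * m powr (q - 1) = m powr q"
        using \<open>0 \<le> m\<close> by (simp add: powr_mult_base)
      then have eq: "q * m powr (q - 1) * m = q * m powr q" by (simp add: mult_ac)
      \<comment> \<open>The tangent at the mean \<open>m\<close> itself; subtracting (q - 1) m^q
        leaves Jensen's inequality.\<close>
      have "q * m powr (q - 1) * m \<le> I + (q - 1) * m powr q"
        using tangent[of m] real \<open>0 \<le> m\<close> \<open>(\<integral>\<^sup>+w. H w \<partial>M) = ennreal m\<close> q
        by (simp add: ennreal_mult[symmetric] ennreal_plus[symmetric] del: ennreal_plus)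
      then have "m powr q \<le> I" unfolding eq by (simp add: algebra_simps)
      then show ?thesis using real \<open>0 \<le> m\<close> \<open>(\<integral>\<^sup>+w. H w \<partial>M) = ennreal m\<close> by (simp add: ennpowr_ennreal ennreal_leI)
    qed simp
  qed
qed

text \<open>For \<open>K\<close> non-negative this bounds the norm of \<open>h\<close> by
  \<open>K\<close>. Comparing powers avoids roots, and values in \<open>ennreal\<close> allow
  mixtures of densities before these are known to be finite.\<close>

definition Lp_bounded :: "ennreal \<Rightarrow> 'a measure \<Rightarrow> real \<Rightarrow> ('a \<Rightarrow> ennreal) \<Rightarrow> bool" where
  "Lp_bounded p M K h \<longleftrightarrow>
    (if p = \<infinity> then AE x in M. h x \<le> ennreal K
     else (\<integral>\<^sup>+x. ennpowr (h x) (enn2real p) \<partial>M) \<le> ennreal (K powr enn2real p))"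

lemma enn2real_ge_1: "1 \<le> p \<Longrightarrow> p \<noteq> \<infinity> \<Longrightarrow> 1 \<le> enn2real p"
  by (metis enn2real_1 enn2real_mono infinity_ennreal_def less_top)

lemma Lp_space_imp_Lp_bounded:
  assumes f: "f \<in> Lp_space p M" and p: "1 \<le> p"
  shows "\<exists>K\<ge>0. Lp_bounded p M K (\<lambda>x. ennreal (f x))"
proof (cases "p = \<infinity>")
  case True
  let ?S = "esssup M (\<lambda>x. ennreal \<bar>f x\<bar>)"
  have fin: "?S < \<infinity>" using f True by (simp add: Lp_space_def Lp_norm_def)
  have "AE x in M. ennreal (f x) \<le> ennreal (enn2real ?S)"
    using esssup_AE[of "\<lambda>x. ennreal \<bar>f x\<bar>" M]
  proof eventually_elim
    case (elim x)
    have "ennreal (f x) \<le> ennreal \<bar>f x\<bar>" by (simp add: ennreal_leI)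
    with elim have "ennreal (f x) \<le> ?S" by (rule order_trans[rotated])
    with fin show ?case by simp
  qed
  then show ?thesis using True by (auto simp: Lp_bounded_def intro!: exI[of _ "enn2real ?S"])
next
  case False
  define q where "q = enn2real p"
  have q: "1 \<le> q" using False p by (simp add: q_def enn2real_ge_1)
  define I where "I = (\<integral>\<^sup>+x. ennreal (\<bar>f x\<bar> powr q) \<partial>M)"
  have fin: "I < \<infinity>"
    using f False by (auto simp: Lp_space_def Lp_norm_def I_def q_def Let_def less_top[symmetric] split: if_splits)
  have "(\<integral>\<^sup>+x. ennpowr (ennreal (f x)) q \<partial>M) \<le> I"
    unfolding I_def
  proof (intro nn_integral_mono)
    fix x
    have "ennpowr (ennreal (f x)) q \<le> ennpowr (ennreal \<bar>f x\<bar>) q"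
      using q by (intro ennpowr_mono) (auto intro: ennreal_leI)
    then show "ennpowr (ennreal (f x)) q \<le> ennreal (\<bar>f x\<bar> powr q)" by (simp add: ennpowr_ennreal)
  qed
  \<comment> \<open>The witness for \<open>K\<close> is the real number behind
    \<open>Lp_norm p M f\<close>.\<close>
  also have "I = ennreal ((enn2real I powr (1 / q)) powr q)"
    using fin q by (simp add: powr_powr)
  finally show ?thesis
    using False by (auto simp: Lp_bounded_def q_def intro!: exI[of _ "enn2real I powr (1 / q)"])
qed

text \<open>The way back from \<open>Lp_bounded\<close> to \<open>Lp_norm\<close>. Domination almost
  everywhere suffices, so it serves both for a density and for a difference of two
  densities.\<close>

lemma Lp_norm_le:
  assumes h: "Lp_bounded p M K h" and K: "0 \<le> K" and p: "1 \<le> p"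
    and [measurable]: "w \<in> borel_measurable M" and le: "AE x in M. ennreal \<bar>w x\<bar> \<le> h x"
  shows "Lp_norm p M w \<le> ennreal K"
proof (cases "p = \<infinity>")
  case True
  with h have "AE x in M. h x \<le> ennreal K" by (simp add: Lp_bounded_def)
  with le have "AE x in M. ennreal \<bar>w x\<bar> \<le> ennreal K" by eventually_elim (rule order_trans)
  then show ?thesis using True by (auto simp: Lp_norm_def intro!: esssup_I)
next
  case False
  define q where "q = enn2real p"
  have q: "1 \<le> q" using False p by (simp add: q_def enn2real_ge_1)
  define I where "I = (\<integral>\<^sup>+x. ennreal (\<bar>w x\<bar> powr q) \<partial>M)"
  have "I \<le> (\<integral>\<^sup>+x. ennpowr (h x) q \<partial>M)"
    unfolding I_def
  proof (intro nn_integral_mono_AE, use le in eventually_elim)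
    case (elim x)
    have "ennpowr (ennreal \<bar>w x\<bar>) q \<le> ennpowr (h x) q"
      using q elim by (intro ennpowr_mono) auto
    then show ?case by (simp add: ennpowr_ennreal)
  qed
  also have "\<dots> \<le> ennreal (K powr q)" using h False by (simp add: Lp_bounded_def q_def)
  finally have I: "I \<le> ennreal (K powr q)" .
  then have "I \<noteq> \<infinity>" by (auto simp: top_unique)
  have "enn2real I powr (1 / q) \<le> (K powr q) powr (1 / q)"
    using I q by (intro powr_mono2) (auto intro: enn2real_leI)
  also have "\<dots> = K" using K q by (simp add: powr_powr)
  finally show ?thesis
    using False \<open>I \<noteq> \<infinity>\<close> by (simp add: Lp_norm_def I_def[symmetric] q_def[symmetric] Let_def ennreal_leI)
qed

lemma Lp_bounded_mono:
  assumes "Lp_bounded p M K h" "0 \<le> K" "K \<le> L"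
  shows "Lp_bounded p M L h"
proof (cases "p = \<infinity>")
  case True
  with assms have "AE x in M. h x \<le> ennreal K" by (simp add: Lp_bounded_def)
  then have "AE x in M. h x \<le> ennreal L"
    by eventually_elim (meson assms(3) ennreal_leI order_trans)
  then show ?thesis using True by (simp add: Lp_bounded_def)
next
  case False
  have "ennreal (K powr enn2real p) \<le> ennreal (L powr enn2real p)"
    using assms by (intro ennreal_leI powr_mono2) auto
  then show ?thesis using assms False by (auto simp: Lp_bounded_def intro: order_trans)
qed

lemma Lp_bounded_cmult:
  assumes h: "Lp_bounded p M K h" and K: "0 \<le> K" and c: "0 \<le> c" and p: "1 \<le> p"
    and [measurable]: "h \<in> borel_measurable M"
  shows "Lp_bounded p M (c * K) (\<lambda>x. ennreal c * h x)"
proof (cases "p = \<infinity>")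
  case True
  with h have "AE x in M. h x \<le> ennreal K" by (simp add: Lp_bounded_def)
  then have "AE x in M. ennreal c * h x \<le> ennreal (c * K)"
    by eventually_elim (use c K in \<open>simp add: ennreal_mult mult_left_mono\<close>)
  then show ?thesis using True by (simp add: Lp_bounded_def)
next
  case False
  define q where "q = enn2real p"
  have q: "1 \<le> q" using False p by (simp add: q_def enn2real_ge_1)
  have "(\<integral>\<^sup>+x. ennpowr (ennreal c * h x) q \<partial>M) = ennreal (c powr q) * (\<integral>\<^sup>+x. ennpowr (h x) q \<partial>M)"
    using c q by (simp add: ennpowr_cmult nn_integral_cmult)
  also have "\<dots> \<le> ennreal (c powr q) * ennreal (K powr q)"
    using h False by (intro mult_left_mono) (auto simp: Lp_bounded_def q_def)
  also have "\<dots> = ennreal ((c * K) powr q)"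
    using c K by (simp add: powr_mult ennreal_mult)
  finally show ?thesis using False by (simp add: Lp_bounded_def q_def)
qed

text \<open>For finite \<open>p\<close> the q-th power of the maximum is at most the sum of the q-th
  powers, which replaces Minkowski's inequality. The constant \<open>2 * K\<close> is generous: 2 is
  at most 2^q because q is at least 1.\<close>

lemma Lp_bounded_max:
  assumes f: "Lp_bounded p M K f" and g: "Lp_bounded p M K g" and K: "0 \<le> K" and p: "1 \<le> p"
    and [measurable]: "f \<in> borel_measurable M" "g \<in> borel_measurable M"
  shows "Lp_bounded p M (2 * K) (\<lambda>x. max (f x) (g x))"
proof (cases "p = \<infinity>")
  case True
  with f g have "AE x in M. f x \<le> ennreal K" "AE x in M. g x \<le> ennreal K" by (simp_all add: Lp_bounded_def)
  then have "AE x in M. max (f x) (g x) \<le> ennreal K" by eventually_elim simp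
  then have "Lp_bounded p M K (\<lambda>x. max (f x) (g x))" using True by (simp add: Lp_bounded_def)
  then show ?thesis using K by (rule Lp_bounded_mono) (use K in auto)
next
  case False
  define q where "q = enn2real p"
  have q: "1 \<le> q" using False p by (simp add: q_def enn2real_ge_1)
  have "(\<integral>\<^sup>+x. ennpowr (max (f x) (g x)) q \<partial>M) \<le> (\<integral>\<^sup>+x. ennpowr (f x) q + ennpowr (g x) q \<partial>M)"
    by (intro nn_integral_mono) (auto simp: max_def add_increasing add_increasing2)
  also have "\<dots> = (\<integral>\<^sup>+x. ennpowr (f x) q \<partial>M) + (\<integral>\<^sup>+x. ennpowr (g x) q \<partial>M)"
    by (simp add: nn_integral_add)
  also have "\<dots> \<le> ennreal (K powr q) + ennreal (K powr q)"
    using f g False by (intro add_mono) (auto simp: Lp_bounded_def q_def)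
  also have "\<dots> = ennreal (2 * K powr q)" by (simp add: ennreal_plus[symmetric] del: ennreal_plus)
  also have "\<dots> \<le> ennreal ((2 * K) powr q)"
    using K q powr_mono[of 1 q 2] by (auto simp: powr_mult intro!: ennreal_leI mult_right_mono)
  finally show ?thesis using False by (simp add: Lp_bounded_def q_def)
qed

text \<open>For finite \<open>p\<close>: Jensen's inequality in \<open>w\<close> at each point
  \<open>x\<close>, then Tonelli. For infinite \<open>p\<close> the exceptional null set may depend
  on \<open>w\<close>, so the two almost-everywhere quantifiers are exchanged first.\<close>

lemma Lp_bounded_mixture:
  assumes Q: "prob_space Q" and M: "sigma_finite_measure M"
    and [measurable]: "(\<lambda>(w, x). H w x) \<in> borel_measurable (Q \<Otimes>\<^sub>M M)"
    and H: "\<And>w. w \<in> space Q \<Longrightarrow> Lp_bounded p M K (H w)" and p: "1 \<le> p"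
  shows "Lp_bounded p M K (\<lambda>x. \<integral>\<^sup>+w. H w x \<partial>Q)"
proof -
  interpret Q: prob_space Q by fact
  interpret M: sigma_finite_measure M by fact
  interpret P: pair_sigma_finite Q M ..
  show ?thesis
  proof (cases "p = \<infinity>")
    case True
    have "AE w in Q. AE x in M. H w x \<le> ennreal K"
      using H True by (intro AE_I2[of Q]) (simp add: Lp_bounded_def)
    then have "AE x in M. AE w in Q. H w x \<le> ennreal K"
      by (subst (asm) P.AE_commute) auto
    then have "AE x in M. (\<integral>\<^sup>+w. H w x \<partial>Q) \<le> ennreal K"
    proof eventually_elim
      case (elim x)
      then have "(\<integral>\<^sup>+w. H w x \<partial>Q) \<le> (\<integral>\<^sup>+w. ennreal K \<partial>Q)" by (rule nn_integral_mono_AE)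
      then show ?case by (simp add: Q.emeasure_space_1)
    qed
    then show ?thesis using True by (simp add: Lp_bounded_def)
  next
    case False
    define q where "q = enn2real p"
    have q: "1 \<le> q" using False p by (simp add: q_def enn2real_ge_1)
    have "(\<integral>\<^sup>+x. ennpowr (\<integral>\<^sup>+w. H w x \<partial>Q) q \<partial>M) \<le> (\<integral>\<^sup>+x. (\<integral>\<^sup>+w. ennpowr (H w x) q \<partial>Q) \<partial>M)"
      by (intro nn_integral_mono Q.ennpowr_nn_integral_le q) auto
    also have "\<dots> = (\<integral>\<^sup>+w. (\<integral>\<^sup>+x. ennpowr (H w x) q \<partial>M) \<partial>Q)"
      by (rule P.Fubini') measurable
    also have "\<dots> \<le> (\<integral>\<^sup>+w. ennreal (K powr q) \<partial>Q)"
      using H False by (intro nn_integral_mono) (simp add: Lp_bounded_def q_def)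
    also have "\<dots> = ennreal (K powr q)" by (simp add: Q.emeasure_space_1)
    finally show ?thesis using False by (simp add: Lp_bounded_def q_def)
  qed
qed

section \<open>The density of a convex combination of independent vectors\<close>

lemma nn_integral_lborel_affine:
  fixes T :: "'a::euclidean_space"
  assumes [measurable]: "F \<in> borel_measurable borel" and a: "a \<noteq> 0"
  shows "(\<integral>\<^sup>+x. F x \<partial>lborel) = ennreal (\<bar>a\<bar> ^ DIM('a)) * (\<integral>\<^sup>+x. F (T + a *\<^sub>R x) \<partial>lborel)"
  by (subst lborel_affine[OF a, of T]) (simp add: nn_integral_density nn_integral_distr nn_integral_cmult)

lemma AE_lborel_affine:
  fixes T :: "'a::euclidean_space"
  assumes ae: "AE x in lborel. P x" and [measurable]: "Measurable.pred borel P" and a: "a \<noteq> 0"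
  shows "AE x in lborel. P (T + a *\<^sub>R x)"
proof -
  have "AE x in density (distr lborel borel (\<lambda>x. T + a *\<^sub>R x)) (\<lambda>_. \<bar>a\<bar> ^ DIM('a)). P x"
    using ae by (subst (asm) lborel_affine[OF a, of T])
  then have "AE x in distr lborel borel (\<lambda>x. T + a *\<^sub>R x). P x"
    using a by (simp add: AE_density)
  then show ?thesis by (subst (asm) AE_distr_iff) auto
qed

text \<open>The substitution produces the Jacobian a^n, which is at most 1 since \<open>a\<close>
  is, so the constant \<open>K\<close> survives.\<close>

lemma Lp_bounded_affine:
  fixes f :: "'a::euclidean_space \<Rightarrow> ennreal"
  assumes f: "Lp_bounded p lborel K f" and K: "0 \<le> K" and p: "1 \<le> p" and a: "0 < a" "a \<le> 1"
    and [measurable]: "f \<in> borel_measurable borel"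
  shows "Lp_bounded p lborel K (\<lambda>x. f ((x - b) /\<^sub>R a))"
proof (cases "p = \<infinity>")
  case True
  with f have "AE x in lborel. f x \<le> ennreal K" by (simp add: Lp_bounded_def)
  then have "AE x in lborel. f (- b /\<^sub>R a + (1 / a) *\<^sub>R x) \<le> ennreal K"
    using a by (intro AE_lborel_affine) auto
  moreover have "- b /\<^sub>R a + (1 / a) *\<^sub>R x = (x - b) /\<^sub>R a" for x
    by (simp add: algebra_simps divide_inverse)
  ultimately show ?thesis using True by (simp add: Lp_bounded_def)
next
  case False
  have "(\<integral>\<^sup>+x. ennpowr (f ((x - b) /\<^sub>R a)) (enn2real p) \<partial>lborel)
      = ennreal (\<bar>a\<bar> ^ DIM('a)) * (\<integral>\<^sup>+x. ennpowr (f ((b + a *\<^sub>R x - b) /\<^sub>R a)) (enn2real p) \<partial>lborel)"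
    using a by (intro nn_integral_lborel_affine) auto
  also have "\<dots> \<le> 1 * (\<integral>\<^sup>+x. ennpowr (f x) (enn2real p) \<partial>lborel)"
    using a by (intro mult_mono) (auto simp: power_le_one)
  also have "\<dots> \<le> ennreal (K powr enn2real p)"
    using f False by (simp add: Lp_bounded_def)
  finally show ?thesis using False by (simp add: Lp_bounded_def)
qed

text \<open>If \<open>Y\<close> has Lebesgue density \<open>f\<close> and \<open>V\<close> has law \<open>N\<close> and is independent of \<open>Y\<close>, then this is
  the Lebesgue density of \<open>a Y + (1 - a) V\<close>.\<close>

definition convex_sum_density ::
    "('a::euclidean_space \<Rightarrow> ennreal) \<Rightarrow> 'a measure \<Rightarrow> real \<Rightarrow> 'a \<Rightarrow> ennreal" where
  "convex_sum_density f N a x =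
    ennreal (1 / a ^ DIM('a)) * (\<integral>\<^sup>+v. f ((x - (1 - a) *\<^sub>R v) /\<^sub>R a) \<partial>N)"

lemma borel_measurable_convex_sum_density:
  fixes f :: "'a::euclidean_space \<Rightarrow> ennreal"
  assumes N: "prob_space N" and sN[measurable_cong]: "sets N = sets borel"
    and [measurable]: "f \<in> borel_measurable borel" "a \<in> borel_measurable M" "x \<in> borel_measurable M"
  shows "(\<lambda>z. convex_sum_density f N (a z) (x z)) \<in> borel_measurable M"
proof -
  interpret N: prob_space N by fact
  show ?thesis
    unfolding convex_sum_density_def by measurable
qed

text \<open>Both sides are the expectation of \<phi>(a Y + (1 - a) V). For fixed \<open>v\<close>,
  substitute x = a y + (1 - a) v; the Jacobian a^n cancels the normalisation 1/a^n.\<close>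

lemma nn_integral_convex_sum_density:
  fixes f \<phi> :: "'a::euclidean_space \<Rightarrow> ennreal"
  assumes N: "prob_space N" and sN[measurable_cong]: "sets N = sets borel" and a: "0 < a"
    and [measurable]: "f \<in> borel_measurable borel" "\<phi> \<in> borel_measurable borel"
  shows "(\<integral>\<^sup>+x. \<phi> x * convex_sum_density f N a x \<partial>lborel)
       = (\<integral>\<^sup>+v. (\<integral>\<^sup>+y. f y * \<phi> (a *\<^sub>R y + (1 - a) *\<^sub>R v) \<partial>lborel) \<partial>N)"
proof -
  interpret N: prob_space N by fact
  interpret P: pair_sigma_finite N lborel ..
  define c where "c = ennreal (1 / a ^ DIM('a))"
  have c: "ennreal (\<bar>a\<bar> ^ DIM('a)) * c = 1"
    using a by (simp add: c_def ennreal_mult[symmetric])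
  have "(\<integral>\<^sup>+x. \<phi> x * convex_sum_density f N a x \<partial>lborel)
      = (\<integral>\<^sup>+x. (\<integral>\<^sup>+v. c * \<phi> x * f ((x - (1 - a) *\<^sub>R v) /\<^sub>R a) \<partial>N) \<partial>lborel)"
    by (intro nn_integral_cong) (simp add: convex_sum_density_def c_def nn_integral_cmult mult_ac)
  also have "\<dots> = (\<integral>\<^sup>+v. (\<integral>\<^sup>+x. c * \<phi> x * f ((x - (1 - a) *\<^sub>R v) /\<^sub>R a) \<partial>lborel) \<partial>N)"
    by (rule P.Fubini') measurable
  also have "\<dots> = (\<integral>\<^sup>+v. (\<integral>\<^sup>+y. f y * \<phi> (a *\<^sub>R y + (1 - a) *\<^sub>R v) \<partial>lborel) \<partial>N)"
  proof (rule nn_integral_cong)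
    fix v
    have "(\<integral>\<^sup>+x. c * \<phi> x * f ((x - (1 - a) *\<^sub>R v) /\<^sub>R a) \<partial>lborel)
        = ennreal (\<bar>a\<bar> ^ DIM('a)) * (\<integral>\<^sup>+y. c * (f y * \<phi> (a *\<^sub>R y + (1 - a) *\<^sub>R v)) \<partial>lborel)"
      using a by (subst nn_integral_lborel_affine[of _ a "(1 - a) *\<^sub>R v"]) (auto simp: mult_ac add_ac)
    also have "\<dots> = (ennreal (\<bar>a\<bar> ^ DIM('a)) * c) * (\<integral>\<^sup>+y. f y * \<phi> (a *\<^sub>R y + (1 - a) *\<^sub>R v) \<partial>lborel)"
      by (subst nn_integral_cmult) (auto simp: mult.assoc)
    finally show "(\<integral>\<^sup>+x. c * \<phi> x * f ((x - (1 - a) *\<^sub>R v) /\<^sub>R a) \<partial>lborel)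
        = (\<integral>\<^sup>+y. f y * \<phi> (a *\<^sub>R y + (1 - a) *\<^sub>R v) \<partial>lborel)"
      by (simp add: c)
  qed
  finally show ?thesis .
qed

text \<open>Up to the factor 1/a^n, the density is a mixture over \<open>v\<close> of translated
  dilates of \<open>f\<close>, each bounded by \<open>K\<close>. The lower bound 1/2 on
  \<open>a\<close> turns the factor into 2^n.\<close>

lemma Lp_bounded_convex_sum_density:
  fixes f :: "'a::euclidean_space \<Rightarrow> ennreal"
  assumes N: "prob_space N" and sN[measurable_cong]: "sets N = sets borel" and a: "1 / 2 \<le> a" "a \<le> 1"
    and [measurable]: "f \<in> borel_measurable borel"
    and f: "Lp_bounded p lborel K f" and K: "0 \<le> K" and p: "1 \<le> p"
  shows "Lp_bounded p lborel (2 ^ DIM('a) * K) (convex_sum_density f N a)"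
proof -
  interpret N: prob_space N by fact
  have "Lp_bounded p lborel K (\<lambda>x. \<integral>\<^sup>+v. f ((x - (1 - a) *\<^sub>R v) /\<^sub>R a) \<partial>N)"
    using a by (intro Lp_bounded_mixture Lp_bounded_affine N sigma_finite_lborel f K p) auto
  then have "Lp_bounded p lborel (1 / a ^ DIM('a) * K) (convex_sum_density f N a)"
    unfolding convex_sum_density_def[abs_def] using a K p by (intro Lp_bounded_cmult) auto
  moreover have "1 / a ^ DIM('a) \<le> 2 ^ DIM('a)"
  proof -
    have "(1 / a) ^ DIM('a) \<le> 2 ^ DIM('a)"
      using a by (intro power_mono) (auto simp: field_simps)
    then show ?thesis by (simp add: power_one_over)
  qed
  then have "1 / a ^ DIM('a) * K \<le> 2 ^ DIM('a) * K"
    using K by (intro mult_right_mono)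
  ultimately show ?thesis
    using K a by (elim Lp_bounded_mono) auto
qed

section \<open>Transport with a random delay\<close>

definition unit_clamp :: "real \<Rightarrow> real" where
  "unit_clamp r = max 0 (min 1 r)"

lemma unit_clamp_bounds [simp]: "0 \<le> unit_clamp r" "unit_clamp r \<le> 1"
  by (auto simp: unit_clamp_def)

lemma unit_clamp_lipschitz: "\<bar>unit_clamp r - unit_clamp s\<bar> \<le> \<bar>r - s\<bar>"
  by (auto simp: unit_clamp_def)

lemma borel_measurable_unit_clamp [measurable]: "unit_clamp \<in> borel_measurable borel"
  unfolding unit_clamp_def[abs_def] by measurable

abbreviation unif :: "real measure" where
  "unif \<equiv> uniform_measure lborel {0..1}"

lemma prob_space_unif: "prob_space unif"
  by (rule prob_space_uniform_measure) auto

text \<open>After the reflection, \<open>t\<close> enters only through the window of integration.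
  This is what makes the density Lipschitz in \<open>t\<close> without any regularity of
  \<open>H\<close>.\<close>

lemma nn_integral_unif_reflect:
  assumes [measurable]: "H \<in> borel_measurable borel"
  shows "(\<integral>\<^sup>+u. H (t - u) \<partial>unif) = (\<integral>\<^sup>+w. H w * indicator {t - 1..t} w \<partial>lborel)"
proof -
  have "(\<integral>\<^sup>+u. H (t - u) \<partial>unif) = (\<integral>\<^sup>+u. H (t - u) * indicator {0..1} u \<partial>lborel)"
    by (simp add: nn_integral_uniform_measure divide_ennreal_def)
  also have "\<dots> = (\<integral>\<^sup>+u. H (t - u) * indicator {t - 1..t} (t - u) \<partial>lborel)"
    by (intro nn_integral_cong) (auto simp: indicator_def)
  also have "\<dots> = (\<integral>\<^sup>+w. H w * indicator {t - 1..t} w \<partial>lborel)"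
    by (subst nn_integral_real_affine[where c = "-1" and t = t]) auto
  finally show ?thesis .
qed

section \<open>The law of the delayed motion and its density\<close>

locale density_pair =
  fixes f g :: "'a::euclidean_space \<Rightarrow> ennreal"
  assumes borel_measurable_f [measurable]: "f \<in> borel_measurable borel"
    and borel_measurable_g [measurable]: "g \<in> borel_measurable borel"
    and prob_f: "prob_space (density lborel f)" and prob_g: "prob_space (density lborel g)"
begin

abbreviation "\<mu> \<equiv> density lborel f"
abbreviation "\<nu> \<equiv> density lborel g"
abbreviation "\<Omega> \<equiv> unif \<Otimes>\<^sub>M (\<mu> \<Otimes>\<^sub>M \<nu>)"

text \<open>In a sample \<open>(u, y, v)\<close>, \<open>u\<close> is the departure time,
  \<open>y\<close> the start and \<open>v\<close> the target; \<open>unit_clamp (t - u)\<close> is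
  the fraction of the way covered by time \<open>t\<close>.\<close>

definition position :: "real \<Rightarrow> real \<times> 'a \<times> 'a \<Rightarrow> 'a" where
  "position t = (\<lambda>(u, y, v). (1 - unit_clamp (t - u)) *\<^sub>R y + unit_clamp (t - u) *\<^sub>R v)"

definition law :: "real \<Rightarrow> 'a measure" where
  "law t = distr \<Omega> borel (position t)"

text \<open>The density of \<open>(1 - r) Y + r V\<close>. For its \<open>L\<^sup>p\<close> bound, the randomness of the summand with the
  larger coefficient has to be used, so that the scaling factor does not blow up.\<close>

definition interpolant :: "real \<Rightarrow> 'a \<Rightarrow> ennreal" where
  "interpolant r x =
    (if r \<le> 1 / 2 then convex_sum_density f \<nu> (1 - r) x else convex_sum_density g \<mu> r x)"

definition law_density :: "real \<Rightarrow> 'a \<Rightarrow> ennreal" where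
  "law_density t x = (\<integral>\<^sup>+u. interpolant (unit_clamp (t - u)) x \<partial>unif)"

lemma prob_space_Omega: "prob_space \<Omega>"
proof -
  interpret M: prob_space \<mu> by (rule prob_f)
  interpret N: prob_space \<nu> by (rule prob_g)
  interpret U: prob_space unif by (rule prob_space_unif)
  interpret P: pair_prob_space \<mu> \<nu> ..
  interpret R: pair_prob_space unif "\<mu> \<Otimes>\<^sub>M \<nu>" ..
  show ?thesis by (rule R.prob_space_axioms)
qed

lemma borel_measurable_position [measurable]: "position t \<in> borel_measurable \<Omega>"
  unfolding position_def by measurable

lemma prob_space_law: "prob_space (law t)"
  unfolding law_def by (rule prob_space.prob_space_distr[OF prob_space_Omega]) measurable

lemma borel_measurable_interpolant:
  assumes [measurable]: "r \<in> borel_measurable M" "x \<in> borel_measurable M"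
  shows "(\<lambda>z. interpolant (r z) (x z)) \<in> borel_measurable M"
proof -
  have [measurable]: "(\<lambda>z. convex_sum_density f \<nu> (1 - r z) (x z)) \<in> borel_measurable M"
    by (intro borel_measurable_convex_sum_density prob_g) auto
  have [measurable]: "(\<lambda>z. convex_sum_density g \<mu> (r z) (x z)) \<in> borel_measurable M"
    by (intro borel_measurable_convex_sum_density prob_f) auto
  show ?thesis unfolding interpolant_def by measurable
qed

declare borel_measurable_interpolant [measurable (raw)]

lemma borel_measurable_law_density [measurable]: "law_density t \<in> borel_measurable borel"
proof -
  interpret U: prob_space unif by (rule prob_space_unif)
  show ?thesis unfolding law_density_def[abs_def] by measurable
qed

text \<open>Whichever summand supplies the randomness, the density obtained is that of the same
  vector. In the first case the two integrals come out in the opposite order and are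
  exchanged.\<close>

lemma nn_integral_interpolant:
  assumes r: "0 \<le> r" "r \<le> 1" and [measurable]: "\<phi> \<in> borel_measurable borel"
  shows "(\<integral>\<^sup>+x. \<phi> x * interpolant r x \<partial>lborel) = (\<integral>\<^sup>+y. (\<integral>\<^sup>+v. \<phi> ((1 - r) *\<^sub>R y + r *\<^sub>R v) \<partial>\<nu>) \<partial>\<mu>)"
proof -
  interpret M: prob_space \<mu> by (rule prob_f)
  interpret N: prob_space \<nu> by (rule prob_g)
  interpret P: pair_prob_space \<mu> \<nu> ..
  show ?thesis
  proof (cases "r \<le> 1 / 2")
    case True
    then have "(\<integral>\<^sup>+x. \<phi> x * interpolant r x \<partial>lborel)
        = (\<integral>\<^sup>+v. (\<integral>\<^sup>+y. f y * \<phi> ((1 - r) *\<^sub>R y + (1 - (1 - r)) *\<^sub>R v) \<partial>lborel) \<partial>\<nu>)"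
      by (simp only: interpolant_def if_True)
         (intro nn_integral_convex_sum_density prob_g; simp)
    also have "\<dots> = (\<integral>\<^sup>+v. (\<integral>\<^sup>+y. \<phi> ((1 - r) *\<^sub>R y + r *\<^sub>R v) \<partial>\<mu>) \<partial>\<nu>)"
      by (intro nn_integral_cong) (simp add: nn_integral_density)
    also have "\<dots> = (\<integral>\<^sup>+y. (\<integral>\<^sup>+v. \<phi> ((1 - r) *\<^sub>R y + r *\<^sub>R v) \<partial>\<nu>) \<partial>\<mu>)"
      by (rule P.Fubini') measurable
    finally show ?thesis .
  next
    case False
    then have "(\<integral>\<^sup>+x. \<phi> x * interpolant r x \<partial>lborel)
        = (\<integral>\<^sup>+y. (\<integral>\<^sup>+v. g v * \<phi> (r *\<^sub>R v + (1 - r) *\<^sub>R y) \<partial>lborel) \<partial>\<mu>)"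
      by (simp only: interpolant_def if_False)
         (intro nn_integral_convex_sum_density prob_f; simp)
    also have "\<dots> = (\<integral>\<^sup>+y. (\<integral>\<^sup>+v. \<phi> ((1 - r) *\<^sub>R y + r *\<^sub>R v) \<partial>\<nu>) \<partial>\<mu>)"
      by (intro nn_integral_cong) (simp add: nn_integral_density add.commute)
    finally show ?thesis .
  qed
qed

text \<open>Conditionally on the delay \<open>u\<close>, the position is an interpolation with fixed
  parameter \<open>unit_clamp (t - u)\<close>; Tonelli then averages the conditional densities over
  \<open>u\<close>.\<close>

lemma law_eq_density: "law t = density lborel (law_density t)"
proof (rule measure_eqI)
  fix A assume "A \<in> sets (law t)"
  then have [measurable]: "A \<in> sets borel" by (simp add: law_def)
  interpret M: prob_space \<mu> by (rule prob_f)
  interpret N: prob_space \<nu> by (rule prob_g)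
  interpret U: prob_space unif by (rule prob_space_unif)
  interpret P: pair_prob_space \<mu> \<nu> ..
  interpret L: pair_sigma_finite unif "lborel :: 'a measure" ..
  have "emeasure (law t) A = (\<integral>\<^sup>+x. indicator A x \<partial>law t)"
    by (simp add: law_def)
  also have "\<dots> = (\<integral>\<^sup>+z. indicator A (position t z) \<partial>\<Omega>)"
    unfolding law_def by (rule nn_integral_distr) auto
  also have "\<dots> = (\<integral>\<^sup>+u. (\<integral>\<^sup>+yv. indicator A (position t (u, yv)) \<partial>(\<mu> \<Otimes>\<^sub>M \<nu>)) \<partial>unif)"
    by (rule P.nn_integral_fst[symmetric]) measurable
  also have "\<dots> = (\<integral>\<^sup>+u. (\<integral>\<^sup>+y. (\<integral>\<^sup>+v. indicator A (position t (u, y, v)) \<partial>\<nu>) \<partial>\<mu>) \<partial>unif)"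
    by (intro nn_integral_cong N.nn_integral_fst[symmetric]) measurable
  also have "\<dots> = (\<integral>\<^sup>+u. (\<integral>\<^sup>+x. indicator A x * interpolant (unit_clamp (t - u)) x \<partial>lborel) \<partial>unif)"
    by (intro nn_integral_cong) (simp add: position_def nn_integral_interpolant)
  also have "\<dots> = (\<integral>\<^sup>+x. (\<integral>\<^sup>+u. indicator A x * interpolant (unit_clamp (t - u)) x \<partial>unif) \<partial>lborel)"
    by (rule L.Fubini'[symmetric]) measurable
  also have "\<dots> = (\<integral>\<^sup>+x. law_density t x * indicator A x \<partial>lborel)"
    unfolding law_density_def by (intro nn_integral_cong, subst nn_integral_cmult) (auto simp: mult.commute)
  also have "\<dots> = emeasure (density lborel (law_density t)) A"
    by (simp add: emeasure_density)
  finally show "emeasure (law t) A = emeasure (density lborel (law_density t)) A" .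
qed (simp add: law_def)

text \<open>The density has integral 1. Finiteness permits the real-valued density that
  \<open>PL_infty\<close> demands.\<close>

lemma AE_law_density_finite: "AE x in lborel. law_density t x \<noteq> \<infinity>"
proof -
  interpret prob_space "density lborel (law_density t)"
    using prob_space_law[of t] by (simp add: law_eq_density)
  have "(\<integral>\<^sup>+x. law_density t x \<partial>lborel) = 1"
    using emeasure_space_1 by (simp add: emeasure_density)
  then show ?thesis by (intro nn_integral_noteq_infinite) auto
qed

lemma law_eq_real_density: "law t = density lborel (\<lambda>x. ennreal (enn2real (law_density t x)))"
  unfolding law_eq_density
  by (intro density_cong) (use AE_law_density_finite[of t] in \<open>auto simp: less_top\<close>)

lemma interpolant_0: "interpolant 0 x = f x"
  using prob_space.emeasure_space_1[OF prob_g] by (simp add: interpolant_def convex_sum_density_def)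

lemma interpolant_1: "interpolant 1 x = g x"
  using prob_space.emeasure_space_1[OF prob_f] by (simp add: interpolant_def convex_sum_density_def)

text \<open>No particle has moved at time 0, since almost every delay lies in [0, 1].\<close>

lemma law_0: "law 0 = \<mu>"
proof -
  interpret U: prob_space unif by (rule prob_space_unif)
  have "law_density 0 x = f x" for x
  proof -
    have "law_density 0 x = (\<integral>\<^sup>+u. f x \<partial>unif)"
      unfolding law_density_def
      by (intro nn_integral_cong_AE AE_uniform_measureI) (auto simp: unit_clamp_def interpolant_0)
    then show ?thesis using U.emeasure_space_1 by simp
  qed
  then have "law_density 0 = f" by (rule ext)
  then show ?thesis by (simp add: law_eq_density)
qed

text \<open>A delay of at most 1 and a journey of length 1 end by time 2, hence the right
  endpoint.\<close>

lemma law_2: "law 2 = \<nu>"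
proof -
  interpret U: prob_space unif by (rule prob_space_unif)
  have "law_density 2 x = g x" for x
  proof -
    have "law_density 2 x = (\<integral>\<^sup>+u. g x \<partial>unif)"
      unfolding law_density_def
      by (intro nn_integral_cong_AE AE_uniform_measureI) (auto simp: unit_clamp_def interpolant_1)
    then show ?thesis using U.emeasure_space_1 by simp
  qed
  then have "law_density 2 = g" by (rule ext)
  then show ?thesis by (simp add: law_eq_density)
qed

end

section \<open>Bounded supports and the Wasserstein estimate\<close>

locale bounded_density_pair = density_pair f g
  for f g :: "'a::euclidean_space \<Rightarrow> ennreal" +
  fixes p :: ennreal and K R :: real
  assumes p: "1 \<le> p" and K: "0 \<le> K" and R: "0 \<le> R"
    and Lp_f: "Lp_bounded p lborel K f" and Lp_g: "Lp_bounded p lborel K g"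
    and AE_f: "AE x in density lborel f. norm x \<le> R" and AE_g: "AE x in density lborel g. norm x \<le> R"
begin

lemma AE_norm_le: "AE (u, y, v) in \<Omega>. norm y \<le> R \<and> norm v \<le> R"
proof -
  interpret M: prob_space \<mu> by (rule prob_f)
  interpret N: prob_space \<nu> by (rule prob_g)
  interpret U: prob_space unif by (rule prob_space_unif)
  interpret P: pair_prob_space \<mu> \<nu> ..
  interpret W: pair_prob_space unif "\<mu> \<Otimes>\<^sub>M \<nu>" ..
  have "AE yv in \<mu> \<Otimes>\<^sub>M \<nu>. norm (fst yv) \<le> R \<and> norm (snd yv) \<le> R"
  proof (rule P.AE_pair_measure)
    show "AE y in \<mu>. AE v in \<nu>. norm (fst (y, v)) \<le> R \<and> norm (snd (y, v)) \<le> R"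
      using AE_f by eventually_elim (use AE_g in auto)
  qed measurable
  then have "AE z in \<Omega>. norm (fst (snd z)) \<le> R \<and> norm (snd (snd z)) \<le> R"
  proof (intro W.AE_pair_measure)
    show "{z \<in> space \<Omega>. norm (fst (snd z)) \<le> R \<and> norm (snd (snd z)) \<le> R} \<in> sets \<Omega>"
      by measurable
  qed auto
  then show ?thesis by (simp add: split_beta)
qed

text \<open>Positions are convex combinations of \<open>y\<close> and \<open>v\<close>, so they stay
  in the ball of radius \<open>R\<close>. The complement of the closed ball is an open null set and
  therefore misses the support.\<close>

lemma law_in_P_infty: "law t \<in> P_infty"
proof -
  have "AE z in \<Omega>. norm (position t z) \<le> R"
    using AE_norm_le
  proof eventually_elim
    case (elim z)
    obtain u y v where z: "z = (u, y, v)" by (cases z)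
    define c where "c = unit_clamp (t - u)"
    have c: "0 \<le> c" "c \<le> 1" by (simp_all add: c_def)
    have "norm ((1 - c) *\<^sub>R y + c *\<^sub>R v) \<le> (1 - c) * norm y + c * norm v"
      using c norm_triangle_ineq[of "(1 - c) *\<^sub>R y" "c *\<^sub>R v"] by simp
    also have "\<dots> \<le> (1 - c) * R + c * R"
      using elim c by (intro add_mono mult_left_mono) (auto simp: z)
    finally show ?case by (simp add: z position_def c_def[symmetric] algebra_simps)
  qed
  then have ae: "AE x in law t. norm x \<le> R"
    unfolding law_def by (subst AE_distr_iff) auto
  have "measure_support (law t) \<subseteq> cball 0 R"
  proof
    fix x assume x: "x \<in> measure_support (law t)"
    show "x \<in> cball 0 R"
    proof (rule ccontr)
      assume "x \<notin> cball 0 R"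
      with x have "0 < emeasure (law t) (- cball 0 R)"
        by (auto simp: measure_support_def open_Compl)
      moreover have "emeasure (law t) (- cball 0 R) = 0"
        using ae by (subst (asm) AE_iff_measurable[where N = "- cball 0 R"]) (auto simp: law_def)
      ultimately show False by simp
    qed
  qed
  then have "bounded (measure_support (law t))" using bounded_cball bounded_subset by blast
  then show ?thesis using prob_space_law[of t] by (simp add: P_infty_def law_def)
qed

text \<open>The coupling observes the same particle at the two times. Its speed is at most the
  distance from \<open>y\<close> to \<open>v\<close>, which is at most \<open>2 * R\<close>.\<close>

lemma W_infty_law: "W_infty (law t) (law s) \<le> ennreal (2 * R * \<bar>t - s\<bar>)"
proof -
  define G where "G = distr \<Omega> borel (\<lambda>z. (position t z, position s z))"
  have [measurable]: "(\<lambda>z. (position t z, position s z)) \<in> borel_measurable \<Omega>"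
    by measurable
  have [measurable]: "fst \<in> (borel :: ('a \<times> 'a) measure) \<rightarrow>\<^sub>M borel" "snd \<in> (borel :: ('a \<times> 'a) measure) \<rightarrow>\<^sub>M borel"
    by (auto intro!: borel_measurable_continuous_onI continuous_intros)
  have "G \<in> couplings (law t) (law s)"
    unfolding couplings_def G_def law_def
    using prob_space.prob_space_distr[OF prob_space_Omega, of "\<lambda>z. (position t z, position s z)" borel]
    by (auto simp: distr_distr comp_def)
  then have "W_infty (law t) (law s) \<le> Lp_norm \<infinity> G (\<lambda>(x, y). norm (x - y))"
    unfolding W_infty_def by (rule INF_lower)
  also have "\<dots> \<le> ennreal (2 * R * \<bar>t - s\<bar>)"
  proof -
    have "AE z in \<Omega>. norm (position t z - position s z) \<le> 2 * R * \<bar>t - s\<bar>"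
      using AE_norm_le
    proof eventually_elim
      case (elim z)
      obtain u y v where z: "z = (u, y, v)" by (cases z)
      define c d where "c = unit_clamp (t - u)" and "d = unit_clamp (s - u)"
      have "position t z - position s z = (c - d) *\<^sub>R (v - y)"
        by (simp add: z position_def c_def d_def algebra_simps)
      then have "norm (position t z - position s z) = \<bar>c - d\<bar> * norm (v - y)" by simp
      also have "\<dots> \<le> \<bar>t - s\<bar> * (2 * R)"
        using elim norm_triangle_ineq4[of v y] unit_clamp_lipschitz[of "t - u" "s - u"]
        by (intro mult_mono) (auto simp: z c_def d_def)
      finally show ?case by (simp add: mult_ac)
    qed
    then have "AE z in G. norm (fst z - snd z) \<le> 2 * R * \<bar>t - s\<bar>"
      unfolding G_def by (subst AE_distr_iff) auto
    then have "AE z in G. ennreal \<bar>case z of (x, y) \<Rightarrow> norm (x - y)\<bar> \<le> ennreal (2 * R * \<bar>t - s\<bar>)"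
      by eventually_elim (auto simp: split_beta intro: ennreal_leI)
    moreover have "(\<lambda>z. ennreal \<bar>case z of (x, y) \<Rightarrow> norm (x - y)\<bar>) \<in> borel_measurable G"
      unfolding G_def split_beta by measurable
    ultimately show ?thesis
      by (simp add: Lp_norm_def esssup_I)
  qed
  finally show ?thesis .
qed

section \<open>The Lipschitz estimate for the densities\<close>

definition density_bound :: real where
  "density_bound = 2 ^ DIM('a) * K"

lemma density_bound_nonneg: "0 \<le> density_bound"
  using K by (simp add: density_bound_def)

text \<open>The bound is uniform in \<open>r\<close> because the branch chosen always has a
  coefficient of at least 1/2.\<close>

lemma Lp_bounded_interpolant:
  assumes "0 \<le> r" "r \<le> 1"
  shows "Lp_bounded p lborel density_bound (interpolant r)"
proof (cases "r \<le> 1 / 2")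
  case True
  then have "interpolant r = convex_sum_density f \<nu> (1 - r)" by (simp add: interpolant_def fun_eq_iff)
  then show ?thesis
    using True assms Lp_bounded_convex_sum_density[OF prob_g _ _ _ _ Lp_f K p, of "1 - r"]
    by (simp add: density_bound_def)
next
  case False
  then have "interpolant r = convex_sum_density g \<mu> r" by (simp add: interpolant_def fun_eq_iff)
  then show ?thesis
    using False assms Lp_bounded_convex_sum_density[OF prob_f _ _ _ _ Lp_g K p, of r]
    by (simp add: density_bound_def)
qed

lemma Lp_bounded_law_density: "Lp_bounded p lborel density_bound (law_density t)"
  unfolding law_density_def[abs_def]
  by (intro Lp_bounded_mixture prob_space_unif sigma_finite_lborel Lp_bounded_interpolant p) auto

lemma law_in_PL_infty: "law t \<in> PL_infty p"
proof -
  have "Lp_norm p lborel (\<lambda>x. enn2real (law_density t x)) \<le> ennreal density_bound"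
    using AE_law_density_finite[of t]
    by (intro Lp_norm_le[OF Lp_bounded_law_density[of t] density_bound_nonneg p]) (auto simp: less_top)
  then have "(\<lambda>x. enn2real (law_density t x)) \<in> Lp_space p lborel"
    by (auto simp: Lp_space_def intro: le_less_trans)
  then show ?thesis
    unfolding PL_infty_def
    by (intro CollectI conjI law_in_P_infty bexI[where x = "\<lambda>x. enn2real (law_density t x)"] law_eq_real_density) auto
qed

text \<open>The contribution of a time window to the density; differences of densities are estimated
  by such contributions of short windows.\<close>

definition increment :: "real \<Rightarrow> real \<Rightarrow> 'a \<Rightarrow> ennreal" where
  "increment a b x = (\<integral>\<^sup>+w. interpolant (unit_clamp w) x * indicator {a..b} w \<partial>lborel)"

lemma borel_measurable_increment [measurable]: "increment a b \<in> borel_measurable borel"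
  unfolding increment_def[abs_def] by measurable

lemma law_density_eq_increment: "law_density t x = increment (t - 1) t x"
  unfolding law_density_def increment_def by (rule nn_integral_unif_reflect) measurable

text \<open>Subadditivity over a cover avoids subtraction in \<open>ennreal\<close> and tolerates
  overlapping windows.\<close>

lemma increment_le_add:
  assumes "{a..b} \<subseteq> {c..d} \<union> {c'..d'}"
  shows "increment a b x \<le> increment c d x + increment c' d' x"
proof -
  have "increment a b x \<le> (\<integral>\<^sup>+w. interpolant (unit_clamp w) x * indicator {c..d} w
      + interpolant (unit_clamp w) x * indicator {c'..d'} w \<partial>lborel)"
    unfolding increment_def using assms by (intro nn_integral_mono) (auto simp: indicator_def)
  then show ?thesis by (simp add: increment_def nn_integral_add)
qed

text \<open>The increment is the length \<open>b - a\<close> times the average over the window, and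
  that average is a mixture of interpolants.\<close>

lemma Lp_bounded_increment:
  assumes "a < b"
  shows "Lp_bounded p lborel ((b - a) * density_bound) (increment a b)"
proof -
  define Q where "Q = uniform_measure lborel {a..b}"
  have sQ[measurable_cong]: "sets Q = sets borel" by (simp add: Q_def)
  have Q: "prob_space Q" using assms unfolding Q_def by (intro prob_space_uniform_measure) auto
  interpret Q: prob_space Q by fact
  have "Lp_bounded p lborel density_bound (\<lambda>x. \<integral>\<^sup>+w. interpolant (unit_clamp w) x \<partial>Q)"
    by (intro Lp_bounded_mixture Q sigma_finite_lborel Lp_bounded_interpolant p) auto
  then have "Lp_bounded p lborel ((b - a) * density_bound)
      (\<lambda>x. ennreal (b - a) * (\<integral>\<^sup>+w. interpolant (unit_clamp w) x \<partial>Q))"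
    using assms p density_bound_nonneg by (intro Lp_bounded_cmult) auto
  moreover have "ennreal (b - a) * (\<integral>\<^sup>+w. interpolant (unit_clamp w) x \<partial>Q) = increment a b x" for x
  proof -
    have "(\<integral>\<^sup>+w. interpolant (unit_clamp w) x \<partial>Q) = increment a b x / ennreal (b - a)"
      using assms unfolding Q_def increment_def by (subst nn_integral_uniform_measure) auto
    then have "ennreal (b - a) * (\<integral>\<^sup>+w. interpolant (unit_clamp w) x \<partial>Q)
        = increment a b x * ennreal (b - a) / ennreal (b - a)"
      by (simp add: ennreal_times_divide mult.commute)
    then show ?thesis using assms by (simp add: ennreal_mult_divide_eq)
  qed
  ultimately show ?thesis by simp
qed

text \<open>Moving the window from [s - 1, s] to [t - 1, t] adds at most the contribution of [s, t]
  and removes at most that of [s - 1, t - 1]. The absolute difference is bounded by the larger of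
  the two; the factor 2 comes from \<open>Lp_bounded_max\<close>.\<close>

lemma Lp_norm_law_density_diff:
  assumes "s < t"
  shows "Lp_norm p lborel (\<lambda>x. enn2real (law_density t x) - enn2real (law_density s x))
    \<le> ennreal (2 * density_bound * (t - s))"
proof -
  let ?h = "\<lambda>x. max (increment s t x) (increment (s - 1) (t - 1) x)"
  have h: "Lp_bounded p lborel (2 * ((t - s) * density_bound)) ?h"
    using assms p density_bound_nonneg Lp_bounded_increment[of s t] Lp_bounded_increment[of "s - 1" "t - 1"]
    by (intro Lp_bounded_max) auto
  have le: "AE x in lborel. ennreal \<bar>enn2real (law_density t x) - enn2real (law_density s x)\<bar> \<le> ?h x"
    using AE_law_density_finite[of t] AE_law_density_finite[of s]
  proof eventually_elim
    case (elim x)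
    \<comment> \<open>The windows [s - 1, s] and [s, t] cover [t - 1, t] even when t - s exceeds
      1.\<close>
    have 1: "law_density t x \<le> law_density s x + ?h x"
      unfolding law_density_eq_increment using assms
      by (intro order_trans[OF increment_le_add add_left_mono[OF max.cobounded1]]) auto
    have 2: "law_density s x \<le> law_density t x + ?h x"
      unfolding law_density_eq_increment using assms
      by (intro order_trans[OF increment_le_add[of _ _ "t - 1" t "s - 1" "t - 1"] add_left_mono[OF max.cobounded2]]) auto
    show ?case
    \<comment> \<open>If the dominating value is infinite nothing is left to show; otherwise all
      quantities are real.\<close>
    proof (cases "?h x")
      case (real k)
      from elim obtain a b where ab: "law_density t x = ennreal a" "0 \<le> a" "law_density s x = ennreal b" "0 \<le> b"
        by (metis ennreal_cases infinity_ennreal_def)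
      have "a \<le> b + k" "b \<le> a + k"
        using 1 2 ab real by (simp_all add: ennreal_plus[symmetric] del: ennreal_plus)
      then have "\<bar>a - b\<bar> \<le> k" by simp
      then show ?thesis unfolding real(2) using ab by (simp add: ennreal_leI)
    qed simp
  qed
  show ?thesis
    using Lp_norm_le[OF h _ p _ le] assms density_bound_nonneg by (simp add: mult_ac)
qed

lemma d_infty_law:
  assumes "s < t"
  shows "d_infty p (law t) (law s) \<le> (2 * R + 2 * density_bound) * (t - s)"
proof -
  \<comment> \<open>The metric may be computed with these representatives in place of the
    Radon-Nikodym derivatives.\<close>
  have "d_infty p (law t) (law s) =
      enn2real (W_infty (law t) (law s)
        + Lp_norm p lborel (\<lambda>x. enn2real (law_density t x) - enn2real (law_density s x)))"
    by (rule d_infty_density) (auto simp: law_eq_real_density[symmetric])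
  also have "\<dots> \<le> enn2real (ennreal (2 * R * \<bar>t - s\<bar>) + ennreal (2 * density_bound * (t - s)))"
    by (intro enn2real_mono add_mono W_infty_law Lp_norm_law_density_diff assms) auto
  also have "\<dots> = 2 * R * (t - s) + 2 * density_bound * (t - s)"
    using assms R density_bound_nonneg by (subst ennreal_plus[symmetric]) (auto simp del: ennreal_plus)
  also have "\<dots> = (2 * R + 2 * density_bound) * (t - s)"
    by (simp add: algebra_simps)
  finally show ?thesis .
qed

lemma abs_continuous_law: "abs_continuous_curve (PL_infty p) (d_infty p) 0 2 law"
proof -
  let ?m = "\<lambda>_::real. 2 * R + 2 * density_bound"
  have "set_integrable lborel {0..2} ?m"
    by (simp add: set_integrable_def)
  moreover have "d_infty p (law t) (law s) \<le> (LINT r:{s..t}|lborel. ?m r)" if "s < t" for s t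
    using d_infty_law[OF that] that by (simp add: set_lebesgue_integral_def mult.commute)
  ultimately show ?thesis
    unfolding abs_continuous_curve_def by (intro conjI ballI exI[of _ ?m] law_in_PL_infty) auto
qed

end

section \<open>From arbitrary endpoints to the setting of the construction\<close>

lemma PL_infty_cases:
  fixes M :: "'a::euclidean_space measure"
  assumes M: "M \<in> PL_infty p" and p: "1 \<le> p"
  obtains f K R where "f \<in> borel_measurable borel" "M = density lborel f" "prob_space M"
    "0 \<le> K" "Lp_bounded p lborel K f" "0 \<le> R" "AE x in M. norm x \<le> R"
proof -
  from M obtain f where f: "f \<in> Lp_space p lborel" "M = density lborel (\<lambda>x. ennreal (f x))"
    by (auto simp: PL_infty_def)
  from Lp_space_imp_Lp_bounded[OF f(1) p] obtain K where K: "0 \<le> K" "Lp_bounded p lborel K (\<lambda>x. ennreal (f x))"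
    by auto
  have M': "prob_space M" "sets M = sets borel" "bounded (measure_support M)"
    using M by (auto simp: PL_infty_def P_infty_def)
  then obtain R where R: "0 < R" "\<And>x. x \<in> measure_support M \<Longrightarrow> norm x \<le> R"
    by (auto simp: bounded_pos)
  \<comment> \<open>A Borel measure is carried by its support, so the bound on the support holds
    almost everywhere.\<close>
  have "AE x in M. norm x \<le> R"
    using AE_measure_support[OF M'(2)] by eventually_elim (rule R(2))
  with f K M' R show ?thesis
    by (intro that[of "\<lambda>x. ennreal (f x)" K R]) (auto simp: Lp_space_def)
qed

theorem theorem1p1:
  fixes \<mu> \<nu> :: "(real ^ 'n) measure" and p :: ennreal
  assumes "1 \<le> p"
    and "\<mu> \<in> PL_infty p" and "\<nu> \<in> PL_infty p"
  shows "\<exists>a b (\<gamma> :: real \<Rightarrow> (real ^ 'n) measure).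
           a < b \<and> abs_continuous_curve (PL_infty p) (d_infty p) a b \<gamma> \<and> \<gamma> a = \<mu> \<and> \<gamma> b = \<nu>"
proof -
  obtain f K R where f: "f \<in> borel_measurable borel" "\<mu> = density lborel f" "prob_space \<mu>"
    "0 \<le> K" "Lp_bounded p lborel K f" "0 \<le> R" "AE x in \<mu>. norm x \<le> R"
    using PL_infty_cases[OF assms(2,1)] .
  obtain g K' R' where g: "g \<in> borel_measurable borel" "\<nu> = density lborel g" "prob_space \<nu>"
    "0 \<le> K'" "Lp_bounded p lborel K' g" "0 \<le> R'" "AE x in \<nu>. norm x \<le> R'"
    using PL_infty_cases[OF assms(3,1)] .
  \<comment> \<open>The locale wants one norm bound and one radius common to both endpoints, hence
    the maxima.\<close>
  interpret bounded_density_pair f g p "max K K'" "max R R'"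
  proof (intro bounded_density_pair.intro density_pair.intro bounded_density_pair_axioms.intro)
    show "AE x in density lborel f. norm x \<le> max R R'" "AE x in density lborel g. norm x \<le> max R R'"
      using f(2,7) g(2,7) by (auto elim!: eventually_mono)
    show "Lp_bounded p lborel (max K K') f" "Lp_bounded p lborel (max K K') g"
      using f(4,5) g(4,5) by (simp_all add: Lp_bounded_mono)
    show "prob_space (density lborel f)" "prob_space (density lborel g)"
      using f(2,3) g(2,3) by simp_all
    show "f \<in> borel_measurable borel" "g \<in> borel_measurable borel"
      by (rule f(1), rule g(1))
    show "1 \<le> p" "0 \<le> max K K'" "0 \<le> max R R'"
      using assms(1) f(4,6) by simp_all
  qed
  show ?thesis
    using abs_continuous_law law_0 law_2 unfolding f(2) g(2)
    by (intro exI[of _ 0] exI[of _ 2] exI[of _ law]) simp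
qed

end
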